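(* Let $I$ be a finitely generated faithful multiplication ideal of a ring $R$, $S$ a multiplicatively closed subset of $R$, and $N$ a submodule of a finitely generated faithful multiplication $R$-module $M$. (1) If $IN$ is a weakly $S$-prime submodule of $M$ and $(N:_{R}M)\cap S=\emptyset$, then either $I$ is a weakly $S$-prime ideal of $R$ or $N$ is a weakly $S$-prime submodule of $M$. (2) $N$ is a weakly $S$-prime submodule of $IM$ if and only if $(N:_{M}I)$ is a weakly $S$-prime submodule of $M$.
   Context: Rings are commutative with non-zero identity and modules are unital. A non-empty subset $S$ of $R$ is multiplicatively closed if it is a subsemigroup of $R$ under multiplication. $(N:_{R}M)=\{r\in R: rM\subseteq N\}$ and $(N:_{M}I)=\{m\in M: Im\subseteq N\}$. An $R$-module is faithful if its annihilator in $R$ is zero. An $R$-module $M$ is a multiplication module if every submodule of $M$ has the form $JM$ for some ideal $J$ of $R$; an ideal is called faithful or multiplication if it is so as an $R$-module. A submodule $N$ of an $R$-module $M$ with $(N:_{R}M)\cap S=\emptyset$ is weakly $S$-prime if there exists a fixed $s\in S$ such that for all $a\in R$, $m\in M$ with $0\neq am\in N$, either $sa\in(N:_{R}M)$ or $sm\in N$. A proper ideal $I$ of $R$ with $I\cap S=\emptyset$ is weakly $S$-prime if there exists $s\in S$ such that for all $a,b\in R$ with $0\neq ab\in I$, either $sa\in I$ or $sb\in I$.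
   Formalization: In (2), N is assumed to be contained in IM; for an arbitrary submodule N of M the "if" direction fails, e.g. R = M = Z, I = 2Z, S = {1}, N = 3Z, where (N:_M I) = 3Z is weakly S-prime but N is not a submodule of IM. *)

theory Defs
  imports "HOL-Algebra.Algebra"
begin

text \<open>
  The multiplication and unit fields of a module record are irrelevant to its module structure;
  here they are filled with those of the ring.
\<close>

definition regular_module :: "('a, 'r) ring_scheme \<Rightarrow> ('a, 'a) module" where
  "regular_module R =
     \<lparr>carrier = carrier R, monoid.mult = monoid.mult R, one = one R,
      ring.zero = ring.zero R, ring.add = ring.add R, smult = monoid.mult R\<rparr>"

definition ideal_module :: "('a, 'r) ring_scheme \<Rightarrow> 'a set \<Rightarrow> ('a, 'a) module" where
  "ideal_module R I = (regular_module R)\<lparr>carrier := I\<rparr>"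

lemma regular_module_is_module:
  assumes "cring R"
  shows "module R (regular_module R)"
proof -
  interpret cring R by fact
  show ?thesis
  proof (rule moduleI)
    show "abelian_group (regular_module R)"
    proof (rule abelian_groupI)
      fix x assume "x \<in> carrier (regular_module R)"
      then show "\<exists>y\<in>carrier (regular_module R).
          y \<oplus>\<^bsub>regular_module R\<^esub> x = \<zero>\<^bsub>regular_module R\<^esub>"
        by (intro bexI[of _ "\<ominus>\<^bsub>R\<^esub> x"]) (simp_all add: regular_module_def l_neg)
    qed (simp_all add: regular_module_def a_ac)
  qed (simp_all add: regular_module_def l_distr r_distr m_assoc assms)
qed

lemma ideal_iff_submodule_regular_module:
  assumes "cring R"
  shows "ideal I R \<longleftrightarrow> submodule I R (regular_module R)"
proof -
  interpret cring R by fact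
  have add: "subgroup I (add_monoid (regular_module R)) \<longleftrightarrow> subgroup I (add_monoid R)"
    by (simp add: regular_module_def subgroup_def m_inv_def)
  show ?thesis
  proof
    assume I: "ideal I R"
    interpret ideal I R by fact
    show "submodule I R (regular_module R)"
      using add a_subgroup
      by (auto simp: submodule_def submodule_axioms_def additive_subgroup_def
            regular_module_def I_l_closed)
  next
    assume S: "submodule I R (regular_module R)"
    then have sub: "subgroup I (add_monoid R)"
      using add by (simp add: submodule_def)
    have cl: "\<And>a x. a \<in> carrier R \<Longrightarrow> x \<in> I \<Longrightarrow> a \<otimes>\<^bsub>R\<^esub> x \<in> I"
      using S by (simp add: submodule_def submodule_axioms_def regular_module_def)
    have "I \<subseteq> carrier R"
      using subgroup.subset[OF sub] by simp
    then show "ideal I R"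
      proof (intro idealI ring_axioms sub)
      fix a x assume "a \<in> I" "x \<in> carrier R"
      then show "x \<otimes>\<^bsub>R\<^esub> a \<in> I" and "a \<otimes>\<^bsub>R\<^esub> x \<in> I"
        using cl[of x a] m_comm[of a x] \<open>I \<subseteq> carrier R\<close> by auto
    qed
  qed
qed

definition submodule_generated ::
    "('a, 'r) ring_scheme \<Rightarrow> ('a, 'b, 'm) module_scheme \<Rightarrow> 'b set \<Rightarrow> 'b set" where
  "submodule_generated R M A = (\<lambda>N. submodule N R M) hull A"

definition finitely_generated_module ::
    "('a, 'r) ring_scheme \<Rightarrow> ('a, 'b, 'm) module_scheme \<Rightarrow> bool" where
  "finitely_generated_module R M \<longleftrightarrow>
     (\<exists>A. finite A \<and> A \<subseteq> carrier M \<and> submodule_generated R M A = carrier M)"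

text \<open>The product \<open>J N\<close> of an ideal and a submodule.\<close>

definition ideal_smult ::
    "('a, 'r) ring_scheme \<Rightarrow> ('a, 'b, 'm) module_scheme \<Rightarrow> 'a set \<Rightarrow> 'b set \<Rightarrow> 'b set" where
  "ideal_smult R M J N = submodule_generated R M {a \<odot>\<^bsub>M\<^esub> n | a n. a \<in> J \<and> n \<in> N}"

text \<open>The residuals \<open>(N :\<^sub>R M)\<close> and \<open>(N :\<^sub>M I)\<close>.\<close>

definition residual_ideal ::
    "('a, 'r) ring_scheme \<Rightarrow> ('a, 'b, 'm) module_scheme \<Rightarrow> 'b set \<Rightarrow> 'a set" where
  "residual_ideal R M N = {r \<in> carrier R. \<forall>m\<in>carrier M. r \<odot>\<^bsub>M\<^esub> m \<in> N}"

definition residual_submodule ::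
    "('a, 'b, 'm) module_scheme \<Rightarrow> 'b set \<Rightarrow> 'a set \<Rightarrow> 'b set" where
  "residual_submodule M N I = {m \<in> carrier M. \<forall>a\<in>I. a \<odot>\<^bsub>M\<^esub> m \<in> N}"

definition module_annihilator ::
    "('a, 'r) ring_scheme \<Rightarrow> ('a, 'b, 'm) module_scheme \<Rightarrow> 'a set" where
  "module_annihilator R M = {r \<in> carrier R. \<forall>m\<in>carrier M. r \<odot>\<^bsub>M\<^esub> m = \<zero>\<^bsub>M\<^esub>}"

definition faithful_module ::
    "('a, 'r) ring_scheme \<Rightarrow> ('a, 'b, 'm) module_scheme \<Rightarrow> bool" where
  "faithful_module R M \<longleftrightarrow> module_annihilator R M = {\<zero>\<^bsub>R\<^esub>}"

definition multiplication_module ::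
    "('a, 'r) ring_scheme \<Rightarrow> ('a, 'b, 'm) module_scheme \<Rightarrow> bool" where
  "multiplication_module R M \<longleftrightarrow>
     (\<forall>N. submodule N R M \<longrightarrow> (\<exists>J. ideal J R \<and> N = ideal_smult R M J (carrier M)))"

text \<open>\<open>S\<close> is a subsemigroup; it need not contain \<open>\<one>\<close>.\<close>

definition multiplicatively_closed :: "('a, 'r) ring_scheme \<Rightarrow> 'a set \<Rightarrow> bool" where
  "multiplicatively_closed R S \<longleftrightarrow>
     S \<noteq> {} \<and> S \<subseteq> carrier R \<and> (\<forall>s\<in>S. \<forall>t\<in>S. s \<otimes>\<^bsub>R\<^esub> t \<in> S)"

definition weakly_S_prime_submodule ::
    "('a, 'r) ring_scheme \<Rightarrow> ('a, 'b, 'm) module_scheme \<Rightarrow> 'a set \<Rightarrow> 'b set \<Rightarrow> bool" where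
  "weakly_S_prime_submodule R M S N \<longleftrightarrow>
     submodule N R M \<and> residual_ideal R M N \<inter> S = {} \<and>
     (\<exists>s\<in>S. \<forall>a\<in>carrier R. \<forall>m\<in>carrier M.
        a \<odot>\<^bsub>M\<^esub> m \<noteq> \<zero>\<^bsub>M\<^esub> \<and> a \<odot>\<^bsub>M\<^esub> m \<in> N \<longrightarrow>
        s \<otimes>\<^bsub>R\<^esub> a \<in> residual_ideal R M N \<or> s \<odot>\<^bsub>M\<^esub> m \<in> N)"

definition weakly_S_prime_ideal ::
    "('a, 'r) ring_scheme \<Rightarrow> 'a set \<Rightarrow> 'a set \<Rightarrow> bool" where
  "weakly_S_prime_ideal R S I \<longleftrightarrow>
     ideal I R \<and> I \<noteq> carrier R \<and> I \<inter> S = {} \<and>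
     (\<exists>s\<in>S. \<forall>a\<in>carrier R. \<forall>b\<in>carrier R.
        a \<otimes>\<^bsub>R\<^esub> b \<noteq> \<zero>\<^bsub>R\<^esub> \<and> a \<otimes>\<^bsub>R\<^esub> b \<in> I \<longrightarrow>
        s \<otimes>\<^bsub>R\<^esub> a \<in> I \<or> s \<otimes>\<^bsub>R\<^esub> b \<in> I)"

end

theory Submission
  imports Defs
begin

text \<open>
  Part (2) compares \<open>N \<subseteq> I M\<close> with \<open>K = (N :\<^sub>M I)\<close>. The ideals \<open>(N :\<^sub>R I M)\<close> and \<open>(K :\<^sub>R M)\<close>
  coincide, so both directions transfer the weakly \<open>S\<close>-prime condition with the same \<open>s\<close>. From \<open>I M\<close>
  to \<open>M\<close>, a product \<open>a m \<in> K\<close> is replaced by the products \<open>a (b m) \<in> N\<close> for \<open>b \<in> I\<close>. From \<open>M\<close> to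
  \<open>I M\<close>, an element \<open>x \<in> I M\<close> is replaced by the elements of \<open>Y = (R x :\<^sub>M I)\<close>, and \<open>I Y\<close> contains
  \<open>x\<close>. In both cases the products that vanish escape the hypothesis, and the lemma
  \<open>smult_mem_if_not_annihilated\<close> recovers them: if \<open>a\<close> kills \<open>y\<close> but not \<open>z\<close>, then it does not kill
  \<open>y + z\<close>, so the hypothesis applies to \<open>z\<close> and to \<open>y + z\<close>.

  Two facts on \<open>I\<close> and \<open>M\<close> make this work: \<open>I m = 0\<close> implies \<open>m = 0\<close>, and \<open>X = I (X :\<^sub>M I)\<close> for each
  submodule \<open>X \<subseteq> I M\<close>. The second one rests on cancellation: for a finitely generated faithful
  multiplication module, \<open>a M \<subseteq> K M\<close> implies \<open>a \<in> K\<close> (lemma \<open>ideal_smult_carrier_cancel\<close>). The proof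
  is local: such a module becomes cyclic at each maximal ideal \<open>P\<close>, because \<open>P M \<noteq> M\<close> and any \<open>x \<notin> P M\<close>
  generates a submodule that contains \<open>c M\<close> for some \<open>c \<notin> P\<close>.

  Part (1) follows from part (2), which yields the second alternative. Cancellation for \<open>M\<close> and
  for \<open>I\<close> as a module yields \<open>(I N :\<^sub>M I) = N\<close>. If \<open>I N\<close> is weakly \<open>S\<close>-prime in \<open>M\<close>, it is so in
  \<open>I M\<close>, since \<open>(I N :\<^sub>R I M) = (N :\<^sub>R M)\<close> is disjoint from \<open>S\<close>. Then \<open>N = (I N :\<^sub>M I)\<close> is weakly
  \<open>S\<close>-prime in \<open>M\<close>.
\<close>

section \<open>Submodules, products and residuals\<close>

lemma (in module) submodule_zero:
  assumes "submodule N R M"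
  shows "\<zero>\<^bsub>M\<^esub> \<in> N"
  using submoduleE(2)[OF assms] submoduleE(1,4)[OF assms]
  by (metis R.zero_closed ex_in_conv smult_l_null subsetD)

lemma (in module) submodule_submodule_generated:
  assumes "A \<subseteq> carrier M"
  shows "submodule (submodule_generated R M A) R M"
proof -
  let ?C = "{N. submodule N R M \<and> A \<subseteq> N}"
  have car: "carrier M \<in> ?C"
    using assms carrier_is_submodule by blast
  have "submodule (\<Inter>?C) R M"
  proof (rule submoduleI)
    show "\<Inter>?C \<subseteq> carrier M"
      using car by blast
    show "\<zero>\<^bsub>M\<^esub> \<in> \<Inter>?C"
      using submodule_zero by blast
  qed (use submoduleE(3,4,5) in blast)+
  then show ?thesis
    by (simp add: submodule_generated_def hull_def)
qed

text \<open>
  The direct check would have to compare the additive inverses of \<open>M\<close> and of its restriction to \<open>H\<close>.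
  It is avoided by noting that both sides say that the restriction to \<open>N\<close> is a module.
\<close>

lemma (in module) submodule_restrict_iff:
  assumes "submodule H R M"
  shows "submodule N R (M\<lparr>carrier := H\<rparr>) \<longleftrightarrow> submodule N R M \<and> N \<subseteq> H"
proof -
  have H: "module R (M\<lparr>carrier := H\<rparr>)"
    using submodule.submodule_is_module[OF assms] module_axioms .
  have HM: "H \<subseteq> carrier M"
    using submoduleE(1)[OF assms] .
  show ?thesis
  proof
    assume N: "submodule N R (M\<lparr>carrier := H\<rparr>)"
    then have "N \<subseteq> H"
      using module.submoduleE(1)[OF H N] by simp
    moreover have "module R (M\<lparr>carrier := N\<rparr>)"
      using submodule.submodule_is_module[OF N H] by simp
    ultimately show "submodule N R M \<and> N \<subseteq> H"
      using module_incl_imp_submodule HM by blast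
  next
    assume N: "submodule N R M \<and> N \<subseteq> H"
    then have "module R (M\<lparr>carrier := N\<rparr>)"
      using submodule.submodule_is_module module_axioms by blast
    then show "submodule N R (M\<lparr>carrier := H\<rparr>)"
      using module.module_incl_imp_submodule[OF H, of N] N by simp
  qed
qed

lemma (in module) submodule_ideal_multiples:
  assumes "ideal J R" "x \<in> carrier M"
  shows "submodule ((\<lambda>r. r \<odot>\<^bsub>M\<^esub> x) ` J) R M"
proof -
  interpret J: ideal J R by fact
  have JR: "r \<in> carrier R" if "r \<in> J" for r
    using that by (rule J.Icarr)
  show ?thesis
  proof (rule submoduleI)
    show "(\<lambda>r. r \<odot>\<^bsub>M\<^esub> x) ` J \<subseteq> carrier M"
      using JR assms(2) by auto
    show "\<zero>\<^bsub>M\<^esub> \<in> (\<lambda>r. r \<odot>\<^bsub>M\<^esub> x) ` J"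
      using assms(2) by (intro image_eqI[of _ _ \<zero>]) auto
  next
    fix a assume "a \<in> (\<lambda>r. r \<odot>\<^bsub>M\<^esub> x) ` J"
    then obtain r where r: "r \<in> J" "a = r \<odot>\<^bsub>M\<^esub> x" by blast
    then show "\<ominus>\<^bsub>M\<^esub> a \<in> (\<lambda>r. r \<odot>\<^bsub>M\<^esub> x) ` J"
      using assms(2) JR by (intro image_eqI[of _ _ "\<ominus> r"]) (auto simp: smult_l_minus)
    fix b assume "b \<in> carrier R"
    then show "b \<odot>\<^bsub>M\<^esub> a \<in> (\<lambda>r. r \<odot>\<^bsub>M\<^esub> x) ` J"
      using r assms(2) JR
      by (intro image_eqI[of _ _ "b \<otimes> r"]) (auto simp: smult_assoc1 J.I_l_closed)
  next
    fix a b assume "a \<in> (\<lambda>r. r \<odot>\<^bsub>M\<^esub> x) ` J" "b \<in> (\<lambda>r. r \<odot>\<^bsub>M\<^esub> x) ` J"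
    then obtain r t where "r \<in> J" "a = r \<odot>\<^bsub>M\<^esub> x" "t \<in> J" "b = t \<odot>\<^bsub>M\<^esub> x" by blast
    then show "a \<oplus>\<^bsub>M\<^esub> b \<in> (\<lambda>r. r \<odot>\<^bsub>M\<^esub> x) ` J"
      using assms(2) JR by (intro image_eqI[of _ _ "r \<oplus> t"]) (auto simp: smult_l_distr)
  qed
qed

lemma (in module) submodule_residual_submodule:
  assumes "submodule T R M" "J \<subseteq> carrier R"
  shows "submodule (residual_submodule M T J) R M"
proof (rule submoduleI)
  show "residual_submodule M T J \<subseteq> carrier M"
    by (auto simp: residual_submodule_def)
  show "\<zero>\<^bsub>M\<^esub> \<in> residual_submodule M T J"
    using assms(2) submodule_zero[OF assms(1)] by (auto simp: residual_submodule_def)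
next
  fix m assume m: "m \<in> residual_submodule M T J"
  then show "\<ominus>\<^bsub>M\<^esub> m \<in> residual_submodule M T J"
    using assms(2) submoduleE(3)[OF assms(1)]
    by (auto simp: residual_submodule_def subset_iff smult_r_minus)
  fix a assume a: "a \<in> carrier R"
  have "b \<odot>\<^bsub>M\<^esub> (a \<odot>\<^bsub>M\<^esub> m) = a \<odot>\<^bsub>M\<^esub> (b \<odot>\<^bsub>M\<^esub> m)" if "b \<in> J" for b
    using that assms(2) a m
    by (metis (mono_tags, lifting) R.m_comm mem_Collect_eq residual_submodule_def smult_assoc1 subsetD)
  then show "a \<odot>\<^bsub>M\<^esub> m \<in> residual_submodule M T J"
    using m a submoduleE(4)[OF assms(1)] by (auto simp: residual_submodule_def)
next
  fix m n assume "m \<in> residual_submodule M T J" "n \<in> residual_submodule M T J"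
  then show "m \<oplus>\<^bsub>M\<^esub> n \<in> residual_submodule M T J"
    using assms(2) submoduleE(5)[OF assms(1)]
    by (auto simp: residual_submodule_def subset_iff smult_r_distr)
qed

lemma (in module) ideal_vimage_smult:
  assumes "submodule T R M" "m \<in> carrier M"
  shows "ideal {r \<in> carrier R. r \<odot>\<^bsub>M\<^esub> m \<in> T} R"
proof (rule idealI)
  show "ring R"
    by (rule R.ring_axioms)
  show "subgroup {r \<in> carrier R. r \<odot>\<^bsub>M\<^esub> m \<in> T} (add_monoid R)"
  proof (rule R.add.subgroupI)
    show "{r \<in> carrier R. r \<odot>\<^bsub>M\<^esub> m \<in> T} \<noteq> {}"
      using submodule_zero[OF assms(1)] assms(2) by (auto intro!: exI[of _ \<zero>])
  next
    fix a assume "a \<in> {r \<in> carrier R. r \<odot>\<^bsub>M\<^esub> m \<in> T}"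
    then show "\<ominus> a \<in> {r \<in> carrier R. r \<odot>\<^bsub>M\<^esub> m \<in> T}"
      using assms(2) submoduleE(3)[OF assms(1)] by (simp add: smult_l_minus)
  next
    fix a b assume "a \<in> {r \<in> carrier R. r \<odot>\<^bsub>M\<^esub> m \<in> T}" "b \<in> {r \<in> carrier R. r \<odot>\<^bsub>M\<^esub> m \<in> T}"
    then show "a \<oplus> b \<in> {r \<in> carrier R. r \<odot>\<^bsub>M\<^esub> m \<in> T}"
      using assms(2) submoduleE(5)[OF assms(1)] by (simp add: smult_l_distr)
  qed auto
next
  fix a x assume a: "a \<in> {r \<in> carrier R. r \<odot>\<^bsub>M\<^esub> m \<in> T}" and x: "x \<in> carrier R"
  then show "x \<otimes> a \<in> {r \<in> carrier R. r \<odot>\<^bsub>M\<^esub> m \<in> T}"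
    using assms(2) submoduleE(4)[OF assms(1)] by (simp add: smult_assoc1)
  then show "a \<otimes> x \<in> {r \<in> carrier R. r \<odot>\<^bsub>M\<^esub> m \<in> T}"
    using a x by (simp add: R.m_comm)
qed

lemma smult_mem_ideal_smult:
  assumes "a \<in> J" "n \<in> N"
  shows "a \<odot>\<^bsub>M\<^esub> n \<in> ideal_smult R M J N"
  unfolding ideal_smult_def submodule_generated_def
  by (rule hull_inc) (use assms in blast)

lemma ideal_smult_subset:
  assumes "submodule T R M"
    and "\<And>a n. a \<in> J \<Longrightarrow> n \<in> N \<Longrightarrow> a \<odot>\<^bsub>M\<^esub> n \<in> T"
  shows "ideal_smult R M J N \<subseteq> T"
  unfolding ideal_smult_def submodule_generated_def
  by (rule hull_minimal) (use assms in blast)+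

lemma (in module) submodule_ideal_smult:
  assumes "J \<subseteq> carrier R" "N \<subseteq> carrier M"
  shows "submodule (ideal_smult R M J N) R M"
  unfolding ideal_smult_def
  by (rule submodule_submodule_generated) (use assms in blast)

text \<open>
  A property of the form \<open>r x \<in> T\<close> needs to be checked only on the products that generate \<open>J N\<close>,
  because the elements \<open>x\<close> that satisfy it form the submodule \<open>(T :\<^sub>M r)\<close>.
\<close>

lemma (in module) smult_ideal_smult_induct:
  assumes "submodule T R M" "r \<in> carrier R" "J \<subseteq> carrier R" "N \<subseteq> carrier M"
    and "\<And>a n. a \<in> J \<Longrightarrow> n \<in> N \<Longrightarrow> r \<odot>\<^bsub>M\<^esub> (a \<odot>\<^bsub>M\<^esub> n) \<in> T"
    and "x \<in> ideal_smult R M J N"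
  shows "r \<odot>\<^bsub>M\<^esub> x \<in> T"
proof -
  have "ideal_smult R M J N \<subseteq> residual_submodule M T {r}"
    using assms(2-5)
    by (intro ideal_smult_subset submodule_residual_submodule assms(1))
      (auto simp: residual_submodule_def subset_iff)
  then show ?thesis
    using assms(6) by (auto simp: residual_submodule_def)
qed

lemma (in module) smult_left_commute:
  assumes "a \<in> carrier R" "b \<in> carrier R" "x \<in> carrier M"
  shows "a \<odot>\<^bsub>M\<^esub> (b \<odot>\<^bsub>M\<^esub> x) = b \<odot>\<^bsub>M\<^esub> (a \<odot>\<^bsub>M\<^esub> x)"
  using assms by (metis R.m_comm smult_assoc1)

text \<open>
  This is the equation \<open>R x = B M\<close> in the form that arguments about elements need: a factor from
  \<open>B\<close> turns every element of \<open>M\<close> into a multiple of \<open>x\<close>.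
\<close>

lemma (in module) multiplication_module_cyclic:
  assumes "multiplication_module R M" "x \<in> carrier M"
  obtains B where "ideal B R" "x \<in> ideal_smult R M B (carrier M)"
    "\<forall>b\<in>B. \<forall>m\<in>carrier M. \<exists>r\<in>carrier R. b \<odot>\<^bsub>M\<^esub> m = r \<odot>\<^bsub>M\<^esub> x"
proof -
  have "submodule ((\<lambda>r. r \<odot>\<^bsub>M\<^esub> x) ` carrier R) R M"
    using submodule_ideal_multiples[OF R.oneideal assms(2)] .
  then obtain B where B: "ideal B R"
      "(\<lambda>r. r \<odot>\<^bsub>M\<^esub> x) ` carrier R = ideal_smult R M B (carrier M)"
    using assms(1) unfolding multiplication_module_def by blast
  have "x \<in> (\<lambda>r. r \<odot>\<^bsub>M\<^esub> x) ` carrier R"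
    using assms(2) by (intro image_eqI[of _ _ \<one>]) auto
  then show thesis
    using that[OF B(1)] smult_mem_ideal_smult[of _ B _ "carrier M" M R]
    unfolding B(2)[symmetric] by blast
qed

section \<open>Cancellation\<close>

lemma (in cring) exists_maximalideal:
  assumes "ideal L R" "L \<noteq> carrier R"
  obtains P where "maximalideal P R" "L \<subseteq> P"
proof -
  let ?A = "{P. ideal P R \<and> L \<subseteq> P \<and> \<one> \<notin> P}"
  have L: "L \<in> ?A"
    using assms ideal.one_imp_carrier by blast
  have "\<exists>P\<in>?A. \<forall>T\<in>?A. P \<subseteq> T \<longrightarrow> T = P"
  proof (rule subset_Zorn_nonempty)
    fix C assume C: "C \<noteq> {}" "subset.chain ?A C"
    then have "subset.chain {I. ideal I R} C" and sub: "C \<subseteq> ?A"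
      by (auto simp: subset_chain_def)
    then have "ideal (\<Union>C) R"
      using chain_Union_is_ideal[of C] C(1) by simp
    then show "\<Union>C \<in> ?A"
      using sub C(1) by blast
  qed (use L in blast)
  then obtain P where P: "P \<in> ?A" and max: "\<forall>T\<in>?A. P \<subseteq> T \<longrightarrow> T = P"
    by (rule bexE)
  have "maximalideal P R"
  proof (rule maximalidealI)
    show "ideal P R" "carrier R \<noteq> P"
      using P by auto
    fix J assume J: "ideal J R" "P \<subseteq> J" "J \<subseteq> carrier R"
    show "J = P \<or> J = carrier R"
    proof (cases "\<one> \<in> J")
      case True
      then show ?thesis
        using ideal.one_imp_carrier[OF J(1)] by simp
    next
      case False
      then have "J \<in> ?A"
        using J(1,2) P by auto
      then show ?thesis
        using max J(2) by simp
    qed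
  qed
  then show thesis
    using that P by blast
qed

text \<open>
  If \<open>R x = B M\<close>, then \<open>R x = B P M = P (B M) = P x\<close>. This is the place where the multiplication
  property spares the determinant argument in Nakayama's lemma.
\<close>

lemma (in module) fixed_by_ideal_element_if_ideal_smult_carrier_eq:
  assumes "multiplication_module R M" "ideal P R"
    and PM: "ideal_smult R M P (carrier M) = carrier M" and x: "x \<in> carrier M"
  shows "\<exists>p\<in>P. x = p \<odot>\<^bsub>M\<^esub> x"
proof -
  interpret P: ideal P R by fact
  obtain B where B: "ideal B R" "x \<in> ideal_smult R M B (carrier M)"
    "\<forall>b\<in>B. \<forall>m\<in>carrier M. \<exists>r\<in>carrier R. b \<odot>\<^bsub>M\<^esub> m = r \<odot>\<^bsub>M\<^esub> x"
    using multiplication_module_cyclic[OF assms(1) x] .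
  interpret B: ideal B R by fact
  have Px: "submodule ((\<lambda>r. r \<odot>\<^bsub>M\<^esub> x) ` P) R M"
    by (rule submodule_ideal_multiples[OF assms(2) x])
  have "b \<odot>\<^bsub>M\<^esub> y \<in> (\<lambda>r. r \<odot>\<^bsub>M\<^esub> x) ` P" if b: "b \<in> B" and y: "y \<in> carrier M" for b y
  proof (rule smult_ideal_smult_induct[OF Px])
    show "y \<in> ideal_smult R M P (carrier M)"
      using y PM by simp
    fix p m assume p: "p \<in> P" and m: "m \<in> carrier M"
    obtain r where r: "r \<in> carrier R" "b \<odot>\<^bsub>M\<^esub> m = r \<odot>\<^bsub>M\<^esub> x"
      using B(3)[rule_format, OF b m] by blast
    have "b \<odot>\<^bsub>M\<^esub> (p \<odot>\<^bsub>M\<^esub> m) = p \<odot>\<^bsub>M\<^esub> (b \<odot>\<^bsub>M\<^esub> m)"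
      using p b m by (intro smult_left_commute) auto
    also have "\<dots> = (p \<otimes> r) \<odot>\<^bsub>M\<^esub> x"
      using r p x by (simp add: smult_assoc1)
    finally show "b \<odot>\<^bsub>M\<^esub> (p \<odot>\<^bsub>M\<^esub> m) \<in> (\<lambda>r. r \<odot>\<^bsub>M\<^esub> x) ` P"
      using p r(1) P.I_r_closed by blast
  qed (use b in auto)
  then have "ideal_smult R M B (carrier M) \<subseteq> (\<lambda>r. r \<odot>\<^bsub>M\<^esub> x) ` P"
    by (intro ideal_smult_subset[OF Px])
  then show ?thesis
    using B(2) by blast
qed

text \<open>
  Each generator \<open>x\<close> is killed by \<open>1 - p\<close> for some \<open>p \<in> P\<close>. The product of these factors over a finite
  generating set is congruent to \<open>1\<close> modulo \<open>P\<close> and kills \<open>M\<close>, so it is zero when \<open>M\<close> is faithful.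
\<close>

lemma (in module) one_mem_if_ideal_smult_carrier_eq:
  assumes "finitely_generated_module R M" "faithful_module R M" "multiplication_module R M"
    and "ideal P R" "ideal_smult R M P (carrier M) = carrier M"
  shows "\<one> \<in> P"
proof -
  interpret P: ideal P R by fact
  obtain A where A: "finite A" "A \<subseteq> carrier M" "submodule_generated R M A = carrier M"
    using assms(1) unfolding finitely_generated_module_def by blast
  have "\<exists>u\<in>carrier R. \<one> \<ominus> u \<in> P \<and> (\<forall>x\<in>A. u \<odot>\<^bsub>M\<^esub> x = \<zero>\<^bsub>M\<^esub>)"
    using A(1,2)
  proof (induction A rule: finite_induct)
    case empty
    show ?case
      by (rule bexI[of _ \<one>]) (auto simp: R.minus_eq R.r_neg)
  next
    case (insert x F)
    then obtain u where u: "u \<in> carrier R" "\<one> \<ominus> u \<in> P" "\<And>y. y \<in> F \<Longrightarrow> u \<odot>\<^bsub>M\<^esub> y = \<zero>\<^bsub>M\<^esub>"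
      by auto
    have x: "x \<in> carrier M" and F: "F \<subseteq> carrier M"
      using insert.prems by auto
    obtain p where p: "p \<in> P" "x = p \<odot>\<^bsub>M\<^esub> x"
      using fixed_by_ideal_element_if_ideal_smult_carrier_eq[OF assms(3-5) x] by blast
    have pR: "p \<in> carrier R"
      using p(1) by simp
    have "(\<one> \<ominus> p) \<odot>\<^bsub>M\<^esub> x = x \<ominus>\<^bsub>M\<^esub> p \<odot>\<^bsub>M\<^esub> x"
      using pR x by (simp add: R.minus_eq M.minus_eq smult_l_distr smult_l_minus)
    also have "\<dots> = \<zero>\<^bsub>M\<^esub>"
      using p(2) x M.r_neg[OF x] by (simp add: M.minus_eq)
    finally have px: "(\<one> \<ominus> p) \<odot>\<^bsub>M\<^esub> x = \<zero>\<^bsub>M\<^esub>" .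
    let ?v = "u \<otimes> (\<one> \<ominus> p)"
    have "\<one> \<ominus> ?v = (\<one> \<ominus> u) \<oplus> u \<otimes> p"
      using u(1) pR by algebra
    then have "\<one> \<ominus> ?v \<in> P"
      using u(1,2) p(1) P.I_l_closed by (simp add: P.a_closed)
    moreover have "?v \<odot>\<^bsub>M\<^esub> x = \<zero>\<^bsub>M\<^esub>"
      using px u(1) pR x by (simp add: smult_assoc1)
    moreover have "?v \<odot>\<^bsub>M\<^esub> y = \<zero>\<^bsub>M\<^esub>" if "y \<in> F" for y
    proof -
      have y: "y \<in> carrier M"
        using that F by blast
      have "?v \<odot>\<^bsub>M\<^esub> y = (\<one> \<ominus> p) \<odot>\<^bsub>M\<^esub> (u \<odot>\<^bsub>M\<^esub> y)"
        using u(1) pR y by (simp add: smult_assoc1 smult_left_commute)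
      then show ?thesis
        using u(3)[OF that] pR by simp
    qed
    ultimately show ?case
      using u(1) pR by (intro bexI[of _ ?v]) auto
  qed
  then obtain u where u: "u \<in> carrier R" "\<one> \<ominus> u \<in> P" "\<And>x. x \<in> A \<Longrightarrow> u \<odot>\<^bsub>M\<^esub> x = \<zero>\<^bsub>M\<^esub>"
    by blast
  have zero: "submodule {\<zero>\<^bsub>M\<^esub>} R M"
    by (rule submoduleI) auto
  have "submodule_generated R M A \<subseteq> residual_submodule M {\<zero>\<^bsub>M\<^esub>} {u}"
    unfolding submodule_generated_def using u A(2)
    by (intro hull_minimal submodule_residual_submodule[OF zero]) (auto simp: residual_submodule_def)
  then have "u \<in> module_annihilator R M"
    using u(1) A(3) by (auto simp: module_annihilator_def residual_submodule_def)
  then have "u = \<zero>"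
    using assms(2) by (simp add: faithful_module_def)
  then show ?thesis
    using u(2) by (simp add: R.minus_eq)
qed

text \<open>
  Suppose that \<open>(K :\<^sub>R a)\<close> is proper and choose a maximal ideal \<open>P\<close> above it. As \<open>P M \<noteq> M\<close>, there are
  \<open>x \<notin> P M\<close> and \<open>c \<notin> P\<close> with \<open>c M \<subseteq> R x\<close>. Then \<open>c a x \<in> c K M \<subseteq> K x\<close>, say \<open>c a x = k x\<close>. So
  \<open>c a - k\<close> kills \<open>x\<close> and hence \<open>c M\<close>; since \<open>M\<close> is faithful, \<open>c (c a - k) = 0\<close>. Therefore
  \<open>c\<^sup>2 a = c k \<in> K\<close>, and \<open>c\<^sup>2 \<in> P\<close>, which contradicts \<open>c \<notin> P\<close>.
\<close>

lemma (in module) ideal_smult_carrier_cancel: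
  assumes fg: "finitely_generated_module R M" and ff: "faithful_module R M"
    and mm: "multiplication_module R M" and K: "ideal K R"
    and a: "a \<in> carrier R"
    and aM: "\<And>m. m \<in> carrier M \<Longrightarrow> a \<odot>\<^bsub>M\<^esub> m \<in> ideal_smult R M K (carrier M)"
  shows "a \<in> K"
proof (rule ccontr)
  assume "a \<notin> K"
  interpret K: ideal K R by fact
  let ?L = "{r \<in> carrier R. r \<otimes> a \<in> K}"
  have L: "ideal ?L R"
    using module.ideal_vimage_smult[OF regular_module_is_module[OF R.is_cring], of K a]
      ideal_iff_submodule_regular_module[OF R.is_cring] K a
    by (simp add: regular_module_def)
  have "\<one> \<notin> ?L"
    using \<open>a \<notin> K\<close> a by simp
  then have "?L \<noteq> carrier R"
    by blast
  then obtain P where "maximalideal P R" and LP: "?L \<subseteq> P"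
    using R.exists_maximalideal[OF L] by blast
  then interpret P: primeideal P R
    by (intro R.maximalideal_prime)
  have "\<one> \<notin> P"
    using P.I_notcarr P.one_imp_carrier by blast
  then have "ideal_smult R M P (carrier M) \<noteq> carrier M"
    using one_mem_if_ideal_smult_carrier_eq[OF fg ff mm P.is_ideal] by blast
  moreover have "ideal_smult R M P (carrier M) \<subseteq> carrier M"
    by (intro ideal_smult_subset carrier_is_submodule) auto
  ultimately obtain x where x: "x \<in> carrier M" "x \<notin> ideal_smult R M P (carrier M)"
    by blast
  obtain B where B: "ideal B R" "x \<in> ideal_smult R M B (carrier M)"
    "\<forall>b\<in>B. \<forall>m\<in>carrier M. \<exists>r\<in>carrier R. b \<odot>\<^bsub>M\<^esub> m = r \<odot>\<^bsub>M\<^esub> x"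
    using multiplication_module_cyclic[OF mm x(1)] .
  interpret B: ideal B R by fact
  have "\<not> B \<subseteq> P"
  proof
    assume "B \<subseteq> P"
    then have "ideal_smult R M B (carrier M) \<subseteq> ideal_smult R M P (carrier M)"
      by (intro ideal_smult_subset submodule_ideal_smult smult_mem_ideal_smult) auto
    then show False
      using B(2) x(2) by blast
  qed
  then obtain c where c: "c \<in> B" "c \<notin> P"
    by blast
  then have cR: "c \<in> carrier R"
    by simp
  have Kx: "submodule ((\<lambda>r. r \<odot>\<^bsub>M\<^esub> x) ` K) R M"
    by (rule submodule_ideal_multiples[OF K x(1)])
  have "c \<odot>\<^bsub>M\<^esub> (a \<odot>\<^bsub>M\<^esub> x) \<in> (\<lambda>r. r \<odot>\<^bsub>M\<^esub> x) ` K"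
  proof (rule smult_ideal_smult_induct[OF Kx])
    show "a \<odot>\<^bsub>M\<^esub> x \<in> ideal_smult R M K (carrier M)"
      using aM[OF x(1)] .
    fix k m assume k: "k \<in> K" and m: "m \<in> carrier M"
    obtain r where r: "r \<in> carrier R" "c \<odot>\<^bsub>M\<^esub> m = r \<odot>\<^bsub>M\<^esub> x"
      using B(3)[rule_format, OF c(1) m] by blast
    have "c \<odot>\<^bsub>M\<^esub> (k \<odot>\<^bsub>M\<^esub> m) = k \<odot>\<^bsub>M\<^esub> (c \<odot>\<^bsub>M\<^esub> m)"
      using k cR m by (intro smult_left_commute) auto
    also have "\<dots> = (k \<otimes> r) \<odot>\<^bsub>M\<^esub> x"
      using r k x(1) by (simp add: smult_assoc1)
    finally show "c \<odot>\<^bsub>M\<^esub> (k \<odot>\<^bsub>M\<^esub> m) \<in> (\<lambda>r. r \<odot>\<^bsub>M\<^esub> x) ` K"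
      using k r(1) K.I_r_closed by blast
  qed (use cR in auto)
  then obtain k where k: "k \<in> K" "c \<odot>\<^bsub>M\<^esub> (a \<odot>\<^bsub>M\<^esub> x) = k \<odot>\<^bsub>M\<^esub> x"
    by blast
  have kR: "k \<in> carrier R"
    using k(1) by simp
  define d where "d = c \<otimes> a \<ominus> k"
  have dR: "d \<in> carrier R"
    unfolding d_def using cR a kR by simp
  have "d \<odot>\<^bsub>M\<^esub> x = c \<odot>\<^bsub>M\<^esub> (a \<odot>\<^bsub>M\<^esub> x) \<ominus>\<^bsub>M\<^esub> k \<odot>\<^bsub>M\<^esub> x"
    unfolding d_def using cR a kR x(1)
    by (simp add: R.minus_eq M.minus_eq smult_l_distr smult_l_minus smult_assoc1)
  then have dx: "d \<odot>\<^bsub>M\<^esub> x = \<zero>\<^bsub>M\<^esub>"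
    using k(2) kR x(1) by (simp add: M.minus_eq M.r_neg)
  have "(c \<otimes> d) \<odot>\<^bsub>M\<^esub> m = \<zero>\<^bsub>M\<^esub>" if m: "m \<in> carrier M" for m
  proof -
    obtain r where r: "r \<in> carrier R" "c \<odot>\<^bsub>M\<^esub> m = r \<odot>\<^bsub>M\<^esub> x"
      using B(3)[rule_format, OF c(1) m] by blast
    have "(c \<otimes> d) \<odot>\<^bsub>M\<^esub> m = d \<odot>\<^bsub>M\<^esub> (r \<odot>\<^bsub>M\<^esub> x)"
      using smult_left_commute[of c d m] cR dR m r(2) by (simp add: smult_assoc1)
    also have "\<dots> = r \<odot>\<^bsub>M\<^esub> (d \<odot>\<^bsub>M\<^esub> x)"
      using dR r(1) x(1) by (rule smult_left_commute)
    finally show ?thesis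
      using dx r(1) by simp
  qed
  then have "c \<otimes> d \<in> module_annihilator R M"
    using cR dR by (simp add: module_annihilator_def)
  then have cd: "c \<otimes> d = \<zero>"
    using ff by (simp add: faithful_module_def)
  have "(c \<otimes> c) \<otimes> a = c \<otimes> d \<oplus> c \<otimes> k"
    unfolding d_def using cR a kR by algebra
  then have "(c \<otimes> c) \<otimes> a \<in> K"
    using cd cR kR k(1) K.I_l_closed by simp
  then have "c \<otimes> c \<in> P"
    using LP cR by blast
  then show False
    using P.I_prime[OF cR cR] c(2) by blast
qed

section \<open>Finitely generated faithful multiplication ideals\<close>

lemma (in cring) ideal_module_is_module:
  assumes "ideal I R"
  shows "module R (ideal_module R I)"
proof -
  have "submodule I R (regular_module R)"
    using assms by (rule iffD1[OF ideal_iff_submodule_regular_module[OF is_cring]])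
  then show ?thesis
    unfolding ideal_module_def
    using regular_module_is_module[OF is_cring] by (rule submodule.submodule_is_module)
qed

lemma (in cring) submodule_ideal_module_iff:
  assumes "ideal I R"
  shows "submodule J R (ideal_module R I) \<longleftrightarrow> ideal J R \<and> J \<subseteq> I"
proof -
  note iff = ideal_iff_submodule_regular_module[OF is_cring]
  show ?thesis
    unfolding ideal_module_def iff
    using regular_module_is_module[OF is_cring] iffD1[OF iff assms]
    by (rule module.submodule_restrict_iff)
qed

lemma ideal_module_simps [simp]:
  "carrier (ideal_module R I) = I" "a \<odot>\<^bsub>ideal_module R I\<^esub> b = a \<otimes>\<^bsub>R\<^esub> b"
  "\<zero>\<^bsub>ideal_module R I\<^esub> = \<zero>\<^bsub>R\<^esub>"
  by (simp_all add: ideal_module_def regular_module_def)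

text \<open>
  If \<open>R x = B M\<close>, then \<open>I B M = I x = 0\<close>. So \<open>I B = 0\<close> as \<open>M\<close> is faithful, and \<open>B = 0\<close> as \<open>I\<close> is.
\<close>

lemma (in module) eq_zero_if_annihilated_by_faithful_ideal:
  assumes I: "ideal I R" and fI: "faithful_module R (ideal_module R I)"
    and ff: "faithful_module R M" and mm: "multiplication_module R M"
    and x: "x \<in> carrier M" "\<And>b. b \<in> I \<Longrightarrow> b \<odot>\<^bsub>M\<^esub> x = \<zero>\<^bsub>M\<^esub>"
  shows "x = \<zero>\<^bsub>M\<^esub>"
proof -
  interpret I: ideal I R by fact
  obtain B where B: "ideal B R" "x \<in> ideal_smult R M B (carrier M)"
    "\<forall>b\<in>B. \<forall>m\<in>carrier M. \<exists>r\<in>carrier R. b \<odot>\<^bsub>M\<^esub> m = r \<odot>\<^bsub>M\<^esub> x"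
    using multiplication_module_cyclic[OF mm x(1)] .
  interpret B: ideal B R by fact
  have B0: "c = \<zero>" if c: "c \<in> B" for c
  proof -
    have "c \<otimes> b = \<zero>" if b: "b \<in> I" for b
    proof -
      have "(c \<otimes> b) \<odot>\<^bsub>M\<^esub> m = \<zero>\<^bsub>M\<^esub>" if m: "m \<in> carrier M" for m
      proof -
        obtain r where r: "r \<in> carrier R" "c \<odot>\<^bsub>M\<^esub> m = r \<odot>\<^bsub>M\<^esub> x"
          using B(3)[rule_format, OF c m] by blast
        have "(c \<otimes> b) \<odot>\<^bsub>M\<^esub> m = b \<odot>\<^bsub>M\<^esub> (r \<odot>\<^bsub>M\<^esub> x)"
          using c b m r(2) by (simp add: smult_assoc1 smult_left_commute)
        also have "\<dots> = r \<odot>\<^bsub>M\<^esub> (b \<odot>\<^bsub>M\<^esub> x)"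
          using b r(1) x(1) by (intro smult_left_commute) auto
        finally show ?thesis
          using x(2)[OF b] r(1) by simp
      qed
      then have "c \<otimes> b \<in> module_annihilator R M"
        using c b by (simp add: module_annihilator_def)
      then show ?thesis
        using ff by (simp add: faithful_module_def)
    qed
    then have "c \<in> module_annihilator R (ideal_module R I)"
      using c by (simp add: module_annihilator_def)
    then show ?thesis
      using fI by (simp add: faithful_module_def)
  qed
  have "ideal_smult R M B (carrier M) \<subseteq> {\<zero>\<^bsub>M\<^esub>}"
  proof (rule ideal_smult_subset)
    show "submodule {\<zero>\<^bsub>M\<^esub>} R M"
      by (rule submoduleI) auto
    fix b m assume "b \<in> B" "m \<in> carrier M"
    then show "b \<odot>\<^bsub>M\<^esub> m \<in> {\<zero>\<^bsub>M\<^esub>}"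
      using B0[of b] by simp
  qed
  then show ?thesis
    using B(2) by blast
qed

text \<open>
  Write \<open>T = L M\<close>. Cancellation turns \<open>L M \<subseteq> I M\<close> into \<open>L \<subseteq> I\<close>, so \<open>L = J I\<close> because \<open>I\<close> is a
  multiplication ideal. Then \<open>T = I (J M)\<close>, and \<open>J M \<subseteq> (T :\<^sub>M I)\<close>.
\<close>

lemma (in module) submodule_subset_ideal_smult_residual:
  assumes I: "ideal I R" and mI: "multiplication_module R (ideal_module R I)"
    and fg: "finitely_generated_module R M" and ff: "faithful_module R M"
    and mm: "multiplication_module R M"
    and T: "submodule T R M" and XI: "T \<subseteq> ideal_smult R M I (carrier M)"
  shows "T \<subseteq> ideal_smult R M I (residual_submodule M T I)"
proof -
  interpret I: ideal I R by fact
  interpret Im: module R "ideal_module R I"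
    by (rule R.ideal_module_is_module[OF I])
  let ?Y = "residual_submodule M T I"
  have IR: "I \<subseteq> carrier R"
    by auto
  have IY: "submodule (ideal_smult R M I ?Y) R M"
    by (rule submodule_ideal_smult[OF IR]) (auto simp: residual_submodule_def)
  obtain L where L: "ideal L R" "T = ideal_smult R M L (carrier M)"
    using mm T unfolding multiplication_module_def by blast
  interpret L: ideal L R by fact
  have LX: "l \<odot>\<^bsub>M\<^esub> m \<in> T" if "l \<in> L" "m \<in> carrier M" for l m
    unfolding L(2) using that by (rule smult_mem_ideal_smult)
  have "L \<subseteq> I"
    using ideal_smult_carrier_cancel[OF fg ff mm I] LX XI L.Icarr by blast
  then have "submodule L R (ideal_module R I)"
    using R.submodule_ideal_module_iff[OF I] L(1) by blast
  then obtain J where J: "ideal J R" "L = ideal_smult R (ideal_module R I) J I"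
    using mI unfolding multiplication_module_def by force
  interpret J: ideal J R by fact
  have "l \<odot>\<^bsub>M\<^esub> m \<in> ideal_smult R M I ?Y" if l: "l \<in> L" and m: "m \<in> carrier M" for l m
  proof -
    let ?Q = "{l \<in> I. l \<odot>\<^bsub>M\<^esub> m \<in> ideal_smult R M I ?Y}"
    have "?Q = I \<inter> {r \<in> carrier R. r \<odot>\<^bsub>M\<^esub> m \<in> ideal_smult R M I ?Y}"
      by auto
    then have "ideal ?Q R"
      using R.i_intersect[OF I ideal_vimage_smult[OF IY m]] by simp
    then have Q: "submodule ?Q R (ideal_module R I)"
      using R.submodule_ideal_module_iff[OF I] by blast
    have "ideal_smult R (ideal_module R I) J I \<subseteq> ?Q"
    proof (rule ideal_smult_subset[OF Q])
      fix j i assume j: "j \<in> J" and i: "i \<in> I"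
      have "b \<odot>\<^bsub>M\<^esub> (j \<odot>\<^bsub>M\<^esub> m) \<in> T" if b: "b \<in> I" for b
      proof -
        have "j \<otimes> b \<in> L"
          unfolding J(2) using smult_mem_ideal_smult[OF j b, of "ideal_module R I" R] by simp
        then show ?thesis
          using LX[of "j \<otimes> b" m] m j b by (simp add: smult_assoc1 smult_left_commute)
      qed
      then have "j \<odot>\<^bsub>M\<^esub> m \<in> ?Y"
        using m j by (simp add: residual_submodule_def)
      then have "i \<odot>\<^bsub>M\<^esub> (j \<odot>\<^bsub>M\<^esub> m) \<in> ideal_smult R M I ?Y"
        using i by (intro smult_mem_ideal_smult)
      then show "j \<odot>\<^bsub>ideal_module R I\<^esub> i \<in> ?Q"
        using i j m I.I_l_closed by (simp add: smult_assoc1 smult_left_commute)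
    qed
    then show ?thesis
      using l J(2) by blast
  qed
  then have "ideal_smult R M L (carrier M) \<subseteq> ideal_smult R M I ?Y"
    by (intro ideal_smult_subset[OF IY])
  then show ?thesis
    unfolding L(2)[symmetric] .
qed

text \<open>
  Write \<open>N = J M\<close> and let \<open>I x \<subseteq> I N\<close> with \<open>R x = B M\<close>. Then \<open>B I M \<subseteq> J I M\<close>. Cancelling \<open>M\<close> gives
  \<open>B I \<subseteq> J I\<close>, and cancelling \<open>I\<close>, which is itself a finitely generated faithful multiplication
  module, gives \<open>B \<subseteq> J\<close>. Hence \<open>x \<in> B M \<subseteq> N\<close>.
\<close>

lemma (in module) residual_submodule_ideal_smult:
  assumes I: "ideal I R" and fgI: "finitely_generated_module R (ideal_module R I)"
    and fI: "faithful_module R (ideal_module R I)"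
    and mI: "multiplication_module R (ideal_module R I)"
    and fg: "finitely_generated_module R M" and ff: "faithful_module R M"
    and mm: "multiplication_module R M"
    and N: "submodule N R M"
  shows "residual_submodule M (ideal_smult R M I N) I = N"
proof
  interpret I: ideal I R by fact
  interpret Im: module R "ideal_module R I"
    by (rule R.ideal_module_is_module[OF I])
  have NM: "N \<subseteq> carrier M"
    using submoduleE(1)[OF N] .
  show "N \<subseteq> residual_submodule M (ideal_smult R M I N) I"
    using NM by (auto simp: residual_submodule_def intro: smult_mem_ideal_smult)
  obtain J where J: "ideal J R" "N = ideal_smult R M J (carrier M)"
    using mm N unfolding multiplication_module_def by blast
  interpret J: ideal J R by fact
  let ?JI = "ideal_smult R (ideal_module R I) J I"
  have "submodule ?JI R (ideal_module R I)"
    by (rule Im.submodule_ideal_smult) auto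
  then have JI: "ideal ?JI R"
    using R.submodule_ideal_module_iff[OF I] by blast
  interpret JI: ideal ?JI R by fact
  have JIM: "submodule (ideal_smult R M ?JI (carrier M)) R M"
    by (rule submodule_ideal_smult) auto
  have "ideal_smult R M I N \<subseteq> ideal_smult R M ?JI (carrier M)"
  proof (rule ideal_smult_subset[OF JIM])
    fix i n assume i: "i \<in> I" and n: "n \<in> N"
    show "i \<odot>\<^bsub>M\<^esub> n \<in> ideal_smult R M ?JI (carrier M)"
    proof (rule smult_ideal_smult_induct[OF JIM])
      show "n \<in> ideal_smult R M J (carrier M)"
        using n J(2) by simp
      fix j m assume j: "j \<in> J" and m: "m \<in> carrier M"
      have "(j \<otimes> i) \<odot>\<^bsub>M\<^esub> m \<in> ideal_smult R M ?JI (carrier M)"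
        using smult_mem_ideal_smult[OF j i, of "ideal_module R I" R] m
        by (intro smult_mem_ideal_smult) simp_all
      then show "i \<odot>\<^bsub>M\<^esub> (j \<odot>\<^bsub>M\<^esub> m) \<in> ideal_smult R M ?JI (carrier M)"
        using i j m by (simp add: smult_assoc1 smult_left_commute)
    qed (use i in auto)
  qed
  note IN = this
  show "residual_submodule M (ideal_smult R M I N) I \<subseteq> N"
  proof
    fix x assume "x \<in> residual_submodule M (ideal_smult R M I N) I"
    then have x: "x \<in> carrier M" and Ix: "\<And>i. i \<in> I \<Longrightarrow> i \<odot>\<^bsub>M\<^esub> x \<in> ideal_smult R M I N"
      by (auto simp: residual_submodule_def)
    obtain B where B: "ideal B R" "x \<in> ideal_smult R M B (carrier M)"
      "\<forall>b\<in>B. \<forall>m\<in>carrier M. \<exists>r\<in>carrier R. b \<odot>\<^bsub>M\<^esub> m = r \<odot>\<^bsub>M\<^esub> x"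
      using multiplication_module_cyclic[OF mm x] .
    interpret B: ideal B R by fact
    have "B \<subseteq> J"
    proof
      fix b assume b: "b \<in> B"
      have "b \<otimes> i \<in> ?JI" if i: "i \<in> I" for i
      proof (rule ideal_smult_carrier_cancel[OF fg ff mm JI])
        show "b \<otimes> i \<in> carrier R"
          using b i by simp
        fix m assume m: "m \<in> carrier M"
        obtain r where r: "r \<in> carrier R" "b \<odot>\<^bsub>M\<^esub> m = r \<odot>\<^bsub>M\<^esub> x"
          using B(3)[rule_format, OF b m] by blast
        have "(b \<otimes> i) \<odot>\<^bsub>M\<^esub> m = i \<odot>\<^bsub>M\<^esub> (r \<odot>\<^bsub>M\<^esub> x)"
          using smult_left_commute[of b i m] b i m r(2) by (simp add: smult_assoc1)
        also have "\<dots> = r \<odot>\<^bsub>M\<^esub> (i \<odot>\<^bsub>M\<^esub> x)"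
          using i r(1) x by (intro smult_left_commute) auto
        finally show "(b \<otimes> i) \<odot>\<^bsub>M\<^esub> m \<in> ideal_smult R M ?JI (carrier M)"
          using Ix[OF i] IN r(1) submoduleE(4)[OF JIM] by auto
      qed
      then show "b \<in> J"
        using Im.ideal_smult_carrier_cancel[OF fgI fI mI J(1), of b] b by simp
    qed
    then have "ideal_smult R M B (carrier M) \<subseteq> N"
      unfolding J(2) by (intro ideal_smult_subset submodule_ideal_smult smult_mem_ideal_smult) auto
    then show "x \<in> N"
      using B(2) by blast
  qed
qed

section \<open>Weakly S-prime submodules\<close>

text \<open>
  This removes the exception that the word ``weakly'' allows: a condition on the elements of \<open>Y\<close> that
  \<open>a\<close> does not kill extends to all of \<open>Y\<close> as soon as \<open>a\<close> does not kill \<open>Y\<close>. Indeed \<open>a y = 0 \<noteq> a z\<close>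
  implies \<open>a (y + z) \<noteq> 0\<close>, and \<open>s y = s (y + z) - s z\<close>.
\<close>

lemma (in module) smult_mem_if_not_annihilated:
  assumes T: "submodule T R M" and Y: "submodule Y R M"
    and a: "a \<in> carrier R" and s: "s \<in> carrier R"
    and nz: "\<And>y. y \<in> Y \<Longrightarrow> a \<odot>\<^bsub>M\<^esub> y \<noteq> \<zero>\<^bsub>M\<^esub> \<Longrightarrow> s \<odot>\<^bsub>M\<^esub> y \<in> T"
    and z: "z \<in> Y" "a \<odot>\<^bsub>M\<^esub> z \<noteq> \<zero>\<^bsub>M\<^esub>" and y: "y \<in> Y"
  shows "s \<odot>\<^bsub>M\<^esub> y \<in> T"
proof (cases "a \<odot>\<^bsub>M\<^esub> y = \<zero>\<^bsub>M\<^esub>")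
  case True
  have yM: "y \<in> carrier M" and zM: "z \<in> carrier M"
    using y z(1) submoduleE(1)[OF Y] by auto
  have "a \<odot>\<^bsub>M\<^esub> (y \<oplus>\<^bsub>M\<^esub> z) \<noteq> \<zero>\<^bsub>M\<^esub>"
    using True z(2) a yM zM by (simp add: smult_r_distr)
  then have "s \<odot>\<^bsub>M\<^esub> (y \<oplus>\<^bsub>M\<^esub> z) \<in> T"
    using nz submoduleE(5)[OF Y] y z(1) by blast
  then have "s \<odot>\<^bsub>M\<^esub> (y \<oplus>\<^bsub>M\<^esub> z) \<oplus>\<^bsub>M\<^esub> \<ominus>\<^bsub>M\<^esub> (s \<odot>\<^bsub>M\<^esub> z) \<in> T"
    using nz[OF z] submoduleE(3,5)[OF T] by blast
  moreover have "s \<odot>\<^bsub>M\<^esub> (y \<oplus>\<^bsub>M\<^esub> z) \<oplus>\<^bsub>M\<^esub> \<ominus>\<^bsub>M\<^esub> (s \<odot>\<^bsub>M\<^esub> z) = s \<odot>\<^bsub>M\<^esub> y"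
    using s yM zM by (simp add: smult_r_distr M.a_assoc M.r_neg)
  ultimately show ?thesis
    by simp
qed (use nz y in blast)

lemma (in module) residual_ideal_restrict_ideal_smult:
  assumes I: "ideal I R" and N: "submodule N R M"
  shows "residual_ideal R (M\<lparr>carrier := ideal_smult R M I (carrier M)\<rparr>) N =
    residual_ideal R M (residual_submodule M N I)"
proof -
  interpret I: ideal I R by fact
  have "(\<forall>h\<in>ideal_smult R M I (carrier M). r \<odot>\<^bsub>M\<^esub> h \<in> N) \<longleftrightarrow>
      (\<forall>m\<in>carrier M. \<forall>b\<in>I. b \<odot>\<^bsub>M\<^esub> (r \<odot>\<^bsub>M\<^esub> m) \<in> N)" (is "?A \<longleftrightarrow> ?B")
    if r: "r \<in> carrier R" for r
  proof
    assume A: ?A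
    show ?B
    proof (intro ballI)
      fix m b assume m: "m \<in> carrier M" and b: "b \<in> I"
      then have "b \<odot>\<^bsub>M\<^esub> m \<in> ideal_smult R M I (carrier M)"
        by (intro smult_mem_ideal_smult)
      then show "b \<odot>\<^bsub>M\<^esub> (r \<odot>\<^bsub>M\<^esub> m) \<in> N"
        using A smult_left_commute[OF r I.Icarr[OF b] m, symmetric] by simp
    qed
  next
    assume B: ?B
    show ?A
    proof
      fix h assume h: "h \<in> ideal_smult R M I (carrier M)"
      show "r \<odot>\<^bsub>M\<^esub> h \<in> N"
      proof (rule smult_ideal_smult_induct[OF N r _ _ _ h])
        fix b m assume "b \<in> I" "m \<in> carrier M"
        then show "r \<odot>\<^bsub>M\<^esub> (b \<odot>\<^bsub>M\<^esub> m) \<in> N"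
          using B smult_left_commute[OF r, of b m] by simp
      qed auto
    qed
  qed
  then show ?thesis
    by (auto simp: residual_ideal_def residual_submodule_def)
qed

text \<open>
  Restricting the ambient module enlarges \<open>(N :\<^sub>R M)\<close>, so the disjointness from \<open>S\<close> is the only
  condition that can be lost.
\<close>

lemma (in module) weakly_S_prime_submodule_restrict:
  assumes "submodule H R M" "N \<subseteq> H" "weakly_S_prime_submodule R M S N"
    and "residual_ideal R (M\<lparr>carrier := H\<rparr>) N \<inter> S = {}"
  shows "weakly_S_prime_submodule R (M\<lparr>carrier := H\<rparr>) S N"
proof -
  have H: "H \<subseteq> carrier M"
    using submoduleE(1)[OF assms(1)] .
  then have res: "residual_ideal R M N \<subseteq> residual_ideal R (M\<lparr>carrier := H\<rparr>) N"
    by (auto simp: residual_ideal_def)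
  show ?thesis
    unfolding weakly_S_prime_submodule_def
  proof (intro conjI)
    show "submodule N R (M\<lparr>carrier := H\<rparr>)"
      using assms(2,3) submodule_restrict_iff[OF assms(1)]
      by (simp add: weakly_S_prime_submodule_def)
    obtain s where "s \<in> S"
      and "\<And>a m. a \<in> carrier R \<Longrightarrow> m \<in> carrier M \<Longrightarrow>
        a \<odot>\<^bsub>M\<^esub> m \<noteq> \<zero>\<^bsub>M\<^esub> \<Longrightarrow> a \<odot>\<^bsub>M\<^esub> m \<in> N \<Longrightarrow>
        s \<otimes> a \<in> residual_ideal R M N \<or> s \<odot>\<^bsub>M\<^esub> m \<in> N"
      using assms(3) unfolding weakly_S_prime_submodule_def by auto
    then show "\<exists>s\<in>S. \<forall>a\<in>carrier R. \<forall>m\<in>carrier (M\<lparr>carrier := H\<rparr>).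
        a \<odot>\<^bsub>M\<lparr>carrier := H\<rparr>\<^esub> m \<noteq> \<zero>\<^bsub>M\<lparr>carrier := H\<rparr>\<^esub> \<and> a \<odot>\<^bsub>M\<lparr>carrier := H\<rparr>\<^esub> m \<in> N \<longrightarrow>
        s \<otimes> a \<in> residual_ideal R (M\<lparr>carrier := H\<rparr>) N \<or> s \<odot>\<^bsub>M\<lparr>carrier := H\<rparr>\<^esub> m \<in> N"
      using H res by (intro bexI[of _ s]) auto
  qed (rule assms(4))
qed

text \<open>
  Given \<open>0 \<noteq> a m \<in> (N :\<^sub>M I)\<close>, the hypothesis applies to the elements \<open>b m\<close> of \<open>I m \<subseteq> I M\<close> with
  \<open>a b m \<noteq> 0\<close>. Such elements exist because \<open>I\<close> annihilates no nonzero element, so \<open>s I m \<subseteq> N\<close>.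
\<close>

lemma (in module) weakly_S_prime_residual_submodule:
  assumes I: "ideal I R" and fI: "faithful_module R (ideal_module R I)"
    and ff: "faithful_module R M" and mm: "multiplication_module R M"
    and S: "S \<subseteq> carrier R"
    and N: "submodule N R M"
    and wN: "weakly_S_prime_submodule R (M\<lparr>carrier := ideal_smult R M I (carrier M)\<rparr>) S N"
  shows "weakly_S_prime_submodule R M S (residual_submodule M N I)"
proof -
  interpret I: ideal I R by fact
  note res = residual_ideal_restrict_ideal_smult[OF I N]
  obtain s where s: "s \<in> S"
    and ws: "\<And>a m. a \<in> carrier R \<Longrightarrow> m \<in> ideal_smult R M I (carrier M) \<Longrightarrow>
      a \<odot>\<^bsub>M\<^esub> m \<noteq> \<zero>\<^bsub>M\<^esub> \<Longrightarrow> a \<odot>\<^bsub>M\<^esub> m \<in> N \<Longrightarrow>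
      s \<otimes> a \<in> residual_ideal R M (residual_submodule M N I) \<or> s \<odot>\<^bsub>M\<^esub> m \<in> N"
    using wN unfolding weakly_S_prime_submodule_def res by auto
  have sR: "s \<in> carrier R"
    using s S by blast
  have "s \<otimes> a \<in> residual_ideal R M (residual_submodule M N I) \<or> s \<odot>\<^bsub>M\<^esub> m \<in> residual_submodule M N I"
    if a: "a \<in> carrier R" and m: "m \<in> carrier M" and am: "a \<odot>\<^bsub>M\<^esub> m \<noteq> \<zero>\<^bsub>M\<^esub>"
      and amN: "a \<odot>\<^bsub>M\<^esub> m \<in> residual_submodule M N I" for a m
  proof (cases "s \<otimes> a \<in> residual_ideal R M (residual_submodule M N I)")
    case False
    obtain c where c: "c \<in> I" "c \<odot>\<^bsub>M\<^esub> (a \<odot>\<^bsub>M\<^esub> m) \<noteq> \<zero>\<^bsub>M\<^esub>"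
      using eq_zero_if_annihilated_by_faithful_ideal[OF I fI ff mm, of "a \<odot>\<^bsub>M\<^esub> m"] a m am by blast
    have "s \<odot>\<^bsub>M\<^esub> (b \<odot>\<^bsub>M\<^esub> m) \<in> N" if b: "b \<in> I" for b
    proof (rule smult_mem_if_not_annihilated[OF N submodule_ideal_multiples[OF I m] a sR])
      show "c \<odot>\<^bsub>M\<^esub> m \<in> (\<lambda>r. r \<odot>\<^bsub>M\<^esub> m) ` I" "b \<odot>\<^bsub>M\<^esub> m \<in> (\<lambda>r. r \<odot>\<^bsub>M\<^esub> m) ` I"
        using b c(1) by blast+
      show "a \<odot>\<^bsub>M\<^esub> (c \<odot>\<^bsub>M\<^esub> m) \<noteq> \<zero>\<^bsub>M\<^esub>"
        using c a m smult_left_commute[of a c m] by simp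
      fix y assume "y \<in> (\<lambda>r. r \<odot>\<^bsub>M\<^esub> m) ` I" and ay: "a \<odot>\<^bsub>M\<^esub> y \<noteq> \<zero>\<^bsub>M\<^esub>"
      then obtain d where d: "d \<in> I" "y = d \<odot>\<^bsub>M\<^esub> m" by blast
      have "a \<odot>\<^bsub>M\<^esub> y = d \<odot>\<^bsub>M\<^esub> (a \<odot>\<^bsub>M\<^esub> m)"
        unfolding d(2) using d(1) a m by (intro smult_left_commute) auto
      then have "a \<odot>\<^bsub>M\<^esub> y \<in> N"
        using amN d(1) by (simp add: residual_submodule_def)
      moreover have "y \<in> ideal_smult R M I (carrier M)"
        unfolding d(2) using d(1) m by (rule smult_mem_ideal_smult)
      ultimately show "s \<odot>\<^bsub>M\<^esub> y \<in> N"
        using ws[OF a] ay False by blast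
    qed
    then have "s \<odot>\<^bsub>M\<^esub> m \<in> residual_submodule M N I"
      using m sR smult_left_commute[OF sR _ m] by (simp add: residual_submodule_def)
    then show ?thesis ..
  qed simp
  moreover have "submodule (residual_submodule M N I) R M"
    by (rule submodule_residual_submodule[OF N]) auto
  moreover have "residual_ideal R M (residual_submodule M N I) \<inter> S = {}"
    using wN unfolding weakly_S_prime_submodule_def res by blast
  ultimately show ?thesis
    using s unfolding weakly_S_prime_submodule_def by blast
qed

text \<open>
  Given \<open>0 \<noteq> a x \<in> N\<close> with \<open>x \<in> I M\<close>, let \<open>Y = (R x :\<^sub>M I)\<close>. Then \<open>I a Y \<subseteq> R a x \<subseteq> N\<close>, that is
  \<open>a Y \<subseteq> (N :\<^sub>M I)\<close>, and \<open>a Y \<noteq> 0\<close> because \<open>x \<in> I Y\<close>. So the hypothesis yields \<open>s Y \<subseteq> (N :\<^sub>M I)\<close>,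
  and \<open>s x \<in> I s Y \<subseteq> N\<close>.
\<close>

lemma (in module) weakly_S_prime_of_residual_submodule:
  assumes I: "ideal I R" and mI: "multiplication_module R (ideal_module R I)"
    and fg: "finitely_generated_module R M" and ff: "faithful_module R M"
    and mm: "multiplication_module R M"
    and S: "S \<subseteq> carrier R"
    and N: "submodule N R M" and NI: "N \<subseteq> ideal_smult R M I (carrier M)"
    and wN: "weakly_S_prime_submodule R M S (residual_submodule M N I)"
  shows "weakly_S_prime_submodule R (M\<lparr>carrier := ideal_smult R M I (carrier M)\<rparr>) S N"
proof -
  interpret I: ideal I R by fact
  let ?H = "ideal_smult R M I (carrier M)" and ?K = "residual_submodule M N I"
  note res = residual_ideal_restrict_ideal_smult[OF I N]
  have H: "submodule ?H R M"
    by (rule submodule_ideal_smult) auto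
  have HM: "?H \<subseteq> carrier M"
    using submoduleE(1)[OF H] .
  obtain s where s: "s \<in> S"
    and ws: "\<And>a m. a \<in> carrier R \<Longrightarrow> m \<in> carrier M \<Longrightarrow>
      a \<odot>\<^bsub>M\<^esub> m \<noteq> \<zero>\<^bsub>M\<^esub> \<Longrightarrow> a \<odot>\<^bsub>M\<^esub> m \<in> ?K \<Longrightarrow>
      s \<otimes> a \<in> residual_ideal R M ?K \<or> s \<odot>\<^bsub>M\<^esub> m \<in> ?K"
    using wN unfolding weakly_S_prime_submodule_def by auto
  have sR: "s \<in> carrier R"
    using s S by blast
  have K: "submodule ?K R M"
    by (rule submodule_residual_submodule[OF N]) auto
  have "s \<otimes> a \<in> residual_ideal R M ?K \<or> s \<odot>\<^bsub>M\<^esub> x \<in> N"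
    if a: "a \<in> carrier R" and xH: "x \<in> ?H" and ax: "a \<odot>\<^bsub>M\<^esub> x \<noteq> \<zero>\<^bsub>M\<^esub>"
      and axN: "a \<odot>\<^bsub>M\<^esub> x \<in> N" for a x
  proof (cases "s \<otimes> a \<in> residual_ideal R M ?K")
    case False
    have x: "x \<in> carrier M"
      using xH HM by blast
    let ?X = "(\<lambda>r. r \<odot>\<^bsub>M\<^esub> x) ` carrier R"
    let ?Y = "residual_submodule M ?X I"
    have T: "submodule ?X R M"
      by (rule submodule_ideal_multiples[OF R.oneideal x])
    have Y: "submodule ?Y R M"
      by (rule submodule_residual_submodule[OF T]) auto
    have YM: "?Y \<subseteq> carrier M"
      using submoduleE(1)[OF Y] .
    have "?X \<subseteq> ?H"
      using submoduleE(4)[OF H] xH by blast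
    then have "?X \<subseteq> ideal_smult R M I ?Y"
      by (rule submodule_subset_ideal_smult_residual[OF I mI fg ff mm T])
    moreover have "x \<in> ?X"
      using x by (intro image_eqI[of _ _ \<one>]) auto
    ultimately have xIY: "x \<in> ideal_smult R M I ?Y"
      by blast
    have aY: "a \<odot>\<^bsub>M\<^esub> y \<in> ?K" if y: "y \<in> ?Y" for y
    proof -
      have "b \<odot>\<^bsub>M\<^esub> (a \<odot>\<^bsub>M\<^esub> y) \<in> N" if b: "b \<in> I" for b
      proof -
        obtain r where r: "r \<in> carrier R" "b \<odot>\<^bsub>M\<^esub> y = r \<odot>\<^bsub>M\<^esub> x"
          using y b by (auto simp: residual_submodule_def)
        have "b \<odot>\<^bsub>M\<^esub> (a \<odot>\<^bsub>M\<^esub> y) = a \<odot>\<^bsub>M\<^esub> (r \<odot>\<^bsub>M\<^esub> x)"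
          using smult_left_commute[of b a y] a b y YM r(2) by auto
        also have "\<dots> = r \<odot>\<^bsub>M\<^esub> (a \<odot>\<^bsub>M\<^esub> x)"
          using a r(1) x by (rule smult_left_commute)
        finally show ?thesis
          using submoduleE(4)[OF N r(1) axN] by simp
      qed
      then show ?thesis
        using a y YM by (auto simp: residual_submodule_def)
    qed
    have "\<exists>z\<in>?Y. a \<odot>\<^bsub>M\<^esub> z \<noteq> \<zero>\<^bsub>M\<^esub>"
    proof (rule ccontr)
      assume no: "\<not> ?thesis"
      have zero: "submodule {\<zero>\<^bsub>M\<^esub>} R M"
        by (rule submoduleI) auto
      have "a \<odot>\<^bsub>M\<^esub> x \<in> {\<zero>\<^bsub>M\<^esub>}"
      proof (rule smult_ideal_smult_induct[OF zero a _ YM _ xIY])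
        fix b y assume b: "b \<in> I" and y: "y \<in> ?Y"
        then show "a \<odot>\<^bsub>M\<^esub> (b \<odot>\<^bsub>M\<^esub> y) \<in> {\<zero>\<^bsub>M\<^esub>}"
          using no a YM smult_left_commute[of a b y] by auto
      qed auto
      then show False
        using ax by simp
    qed
    then obtain z where z: "z \<in> ?Y" "a \<odot>\<^bsub>M\<^esub> z \<noteq> \<zero>\<^bsub>M\<^esub>"
      by blast
    have sY: "s \<odot>\<^bsub>M\<^esub> y \<in> ?K" if y: "y \<in> ?Y" for y
      using smult_mem_if_not_annihilated[OF K Y a sR _ z y] ws[OF a] aY YM False by blast
    have "s \<odot>\<^bsub>M\<^esub> x \<in> N"
    proof (rule smult_ideal_smult_induct[OF N sR _ YM _ xIY])
      fix b y assume b: "b \<in> I" and y: "y \<in> ?Y"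
      then have "b \<odot>\<^bsub>M\<^esub> (s \<odot>\<^bsub>M\<^esub> y) \<in> N"
        using sY by (auto simp: residual_submodule_def)
      then show "s \<odot>\<^bsub>M\<^esub> (b \<odot>\<^bsub>M\<^esub> y) \<in> N"
        using smult_left_commute[of s b y] sR b y YM by auto
    qed auto
    then show ?thesis ..
  qed simp
  moreover have "residual_ideal R M ?K \<inter> S = {}"
    using wN unfolding weakly_S_prime_submodule_def by blast
  ultimately show ?thesis
    using s N NI submodule_restrict_iff[OF H, of N]
    unfolding weakly_S_prime_submodule_def res by auto
qed

theorem proposition1:
  fixes R :: "('a, 'r) ring_scheme" and M :: "('a, 'b, 'm) module_scheme"
    and I S :: "'a set" and N :: "'b set"
  assumes "cring R" and "\<one>\<^bsub>R\<^esub> \<noteq> \<zero>\<^bsub>R\<^esub>"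
    and "ideal I R"
    and "finitely_generated_module R (ideal_module R I)"
    and "faithful_module R (ideal_module R I)"
    and "multiplication_module R (ideal_module R I)"
    and "multiplicatively_closed R S"
    and "module R M"
    and "finitely_generated_module R M"
    and "faithful_module R M"
    and "multiplication_module R M"
    and "submodule N R M"
  shows "(weakly_S_prime_submodule R M S (ideal_smult R M I N) \<and>
            residual_ideal R M N \<inter> S = {} \<longrightarrow>
            weakly_S_prime_ideal R S I \<or> weakly_S_prime_submodule R M S N) \<and>
         (N \<subseteq> ideal_smult R M I (carrier M) \<longrightarrow>
            (weakly_S_prime_submodule R (M\<lparr>carrier := ideal_smult R M I (carrier M)\<rparr>) S N \<longleftrightarrow>
             weakly_S_prime_submodule R M S (residual_submodule M N I)))"
proof -
  interpret module R M by fact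
  note I = assms(3) and fgI = assms(4) and fI = assms(5) and mI = assms(6)
    and fg = assms(9) and ff = assms(10) and mm = assms(11) and N = assms(12)
  interpret I: ideal I R by fact
  have S: "S \<subseteq> carrier R"
    using assms(7) by (simp add: multiplicatively_closed_def)
  let ?H = "ideal_smult R M I (carrier M)"
  have NM: "N \<subseteq> carrier M"
    using submoduleE(1)[OF N] .
  have H: "submodule ?H R M" and IN: "submodule (ideal_smult R M I N) R M"
    using NM by (auto intro!: submodule_ideal_smult)
  have NH: "ideal_smult R M I N \<subseteq> ?H"
    using NM by (intro ideal_smult_subset[OF H] smult_mem_ideal_smult) auto
  note N_eq = residual_submodule_ideal_smult[OF I fgI fI mI fg ff mm N]
  have "weakly_S_prime_submodule R M S N"
    if w: "weakly_S_prime_submodule R M S (ideal_smult R M I N)"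
      and disj: "residual_ideal R M N \<inter> S = {}"
  proof -
    have "residual_ideal R (M\<lparr>carrier := ?H\<rparr>) (ideal_smult R M I N) \<inter> S = {}"
      using disj residual_ideal_restrict_ideal_smult[OF I IN] N_eq by simp
    then have "weakly_S_prime_submodule R (M\<lparr>carrier := ?H\<rparr>) S (ideal_smult R M I N)"
      by (rule weakly_S_prime_submodule_restrict[OF H NH w])
    then show ?thesis
      using weakly_S_prime_residual_submodule[OF I fI ff mm S IN] N_eq by simp
  qed
  then show ?thesis
    using weakly_S_prime_residual_submodule[OF I fI ff mm S N]
      weakly_S_prime_of_residual_submodule[OF I mI fg ff mm S N] by blast
qed

end
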